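(* Consider a semistable system $\dot x(t)=Ax(t)+Bu(t)$, $y(t)=Cx(t)$, with $A\in\mathbb{R}^{n\times n}$, $B\in\mathbb{R}^{n\times p}$, $C\in\mathbb{R}^{q\times n}$, and with pseudo controllability and observability Gramians $\mathcal{P}$ and $\mathcal{Q}$, respectively. Let $m$ be the algebraic (equivalently, geometric) multiplicity of the zero eigenvalue of $A$. Then: (1) the system is controllable if and only if $\mathrm{rank}(\mathcal{P})=n-m$ and $\xi^\top B\neq 0$ for every nonzero vector $\xi\in\ker(A^\top)$; (2) the system is observable if and only if $\mathrm{rank}(\mathcal{Q})=n-m$ and $C\xi\neq 0$ for every nonzero vector $\xi\in\ker(A)$.
   Context: The system $\dot x=Ax+Bu$, $y=Cx$ is called semistable if $\lim_{t\to\infty}x(t)$ exists for all initial states $x(0)$ when $u=0$; equivalently, the zero eigenvalues of $A$ are semisimple (geometric and algebraic multiplicities coincide) and all other eigenvalues have negative real parts. For a semistable system, $\mathcal{J}:=\lim_{\tau\to\infty}e^{A\tau}$, and the pseudo controllability and observability Gramians are $$\mathcal{P}=\int_0^\infty(e^{A\tau}-\mathcal{J})BB^\top(e^{A^\top\tau}-\mathcal{J}^\top)\,d\tau,\qquad \mathcal{Q}=\int_0^\infty(e^{A^\top\tau}-\mathcal{J}^\top)C^\top C(e^{A\tau}-\mathcal{J})\,d\tau .$$ *)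

theory Defs
  imports
    "HOL-Analysis.Analysis"
    "HOL-Computational_Algebra.Polynomial"
begin

subsection \<open>Matrix exponential and algebraic multiplicity\<close>

text \<open>On the type \<open>real^'n^'n\<close> the class operation \<open>*\<close> is componentwise, so
  powers are taken with respect to \<open>**\<close> and the exponential is given by its power series.\<close>

definition matrix_pow :: "real^'n^'n \<Rightarrow> nat \<Rightarrow> real^'n^'n" where
  "matrix_pow A k = (((**) A) ^^ k) (mat 1)"

definition matrix_exp :: "real^'n^'n \<Rightarrow> real^'n^'n" where
  "matrix_exp A = (\<Sum>k. (1 / fact k) *\<^sub>R matrix_pow A k)"

definition char_polynomial :: "real^'n^'n \<Rightarrow> real poly" where
  "char_polynomial A = det (mat [:0, 1:] - map_matrix (\<lambda>a. [:a:]) A)"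

definition algebraic_multiplicity :: "real^'n^'n \<Rightarrow> real \<Rightarrow> nat" where
  "algebraic_multiplicity A c = order c (char_polynomial A)"

subsection \<open>Trajectories of \<open>x' = A x + B u\<close>, \<open>y = C x\<close>\<close>

text \<open>Inputs on \<open>[0,T]\<close> are Lebesgue integrable; the differential equation is understood in
  Caratheodory's sense, i.e. as the integral equation
  \<open>x t = x 0 + \<integral>\<^sub>0\<^sup>t (A x + B u)\<close>. For continuous inputs these are exactly the
  classical solutions.\<close>

definition trajectory ::
  "real^'n^'n \<Rightarrow> real^'p^'n \<Rightarrow> real \<Rightarrow> (real \<Rightarrow> real^'p) \<Rightarrow> (real \<Rightarrow> real^'n) \<Rightarrow> bool" where
  "trajectory A B T u x \<longleftrightarrow>
     u absolutely_integrable_on {0..T} \<and>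
     (\<forall>t\<in>{0..T}. ((\<lambda>s. A *v x s + B *v u s) has_integral (x t - x 0)) {0..t})"

definition semistable :: "real^'n^'n \<Rightarrow> real^'p^'n \<Rightarrow> bool" where
  "semistable A B \<longleftrightarrow>
     (\<forall>x. (\<forall>T\<ge>0. trajectory A B T (\<lambda>_. 0) x) \<longrightarrow> (\<exists>l. (x \<longlongrightarrow> l) at_top))"

definition controllable :: "real^'n^'n \<Rightarrow> real^'p^'n \<Rightarrow> bool" where
  "controllable A B \<longleftrightarrow>
     (\<forall>x0 x1. \<exists>T>0. \<exists>u x. trajectory A B T u x \<and> x 0 = x0 \<and> x T = x1)"

text \<open>Observability: over some finite horizon, input and output determine the initial state. The
  input space is carried along through \<open>B\<close>.\<close>

definition observable :: "real^'n^'n \<Rightarrow> real^'p^'n \<Rightarrow> real^'n^'q \<Rightarrow> bool" where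
  "observable A B C \<longleftrightarrow>
     (\<exists>T>0. \<forall>u x x'. trajectory A B T u x \<and> trajectory A B T u x' \<and>
        (\<forall>t\<in>{0..T}. C *v x t = C *v x' t) \<longrightarrow> x 0 = x' 0)"

subsection \<open>Pseudo Gramians\<close>

definition limit_matrix :: "real^'n^'n \<Rightarrow> real^'n^'n" where
  "limit_matrix A = Lim at_top (\<lambda>\<tau>. matrix_exp (\<tau> *\<^sub>R A))"

definition pseudo_ctrb_gramian :: "real^'n^'n \<Rightarrow> real^'p^'n \<Rightarrow> real^'n^'n" where
  "pseudo_ctrb_gramian A B =
     integral {0..} (\<lambda>\<tau>.
       (matrix_exp (\<tau> *\<^sub>R A) - limit_matrix A) ** B ** transpose B **
       (matrix_exp (\<tau> *\<^sub>R transpose A) - transpose (limit_matrix A)))"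

definition pseudo_obsv_gramian :: "real^'n^'n \<Rightarrow> real^'n^'q \<Rightarrow> real^'n^'n" where
  "pseudo_obsv_gramian A C =
     integral {0..} (\<lambda>\<tau>.
       (matrix_exp (\<tau> *\<^sub>R transpose A) - transpose (limit_matrix A)) ** transpose C ** C **
       (matrix_exp (\<tau> *\<^sub>R A) - limit_matrix A))"

end

theory Submission
  imports Defs
begin

text \<open>Both properties are governed by the unobservable space
  \<open>{x. \<forall>k. C A\<^sup>k x = 0} = {x. \<forall>t. C e\<^bsup>At\<^esup> x = 0}\<close>: the system is observable iff this space vanishes
  for \<open>(A, C)\<close>, and controllable iff it vanishes for \<open>(A\<^sup>T, B\<^sup>T)\<close>. Write
  \<open>F t = e\<^bsup>At\<^esup> - J\<close>, which decays exponentially because \<open>F (s + t) = F s F t\<close>. Then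
  \<open>x \<bullet> Q x = \<integral> \<bar>C F x\<bar>\<^sup>2\<close>, so \<open>Q x = 0\<close> iff the output from the initial state
  \<open>x - J x\<close> vanishes. As \<open>J\<close> is the projection onto \<open>ker A\<close>
  along \<open>range A\<close>, the rank condition says that the unobservable space meets \<open>range A\<close> trivially,
  and the condition on \<open>C\<close> says that it meets \<open>ker A\<close> trivially. The controllability part is the
  same statement for the transposed pair.\<close>

section \<open>The matrix exponential\<close>

lemma matrix_mult_scaleR_left: "(c *\<^sub>R A) ** B = c *\<^sub>R (A ** B)"
  for A :: "real^'n^'m" and B :: "real^'p^'n"
  by (simp add: matrix_matrix_mult_def vec_eq_iff sum_distrib_left mult.assoc)

lemma matrix_mult_scaleR_right: "A ** (c *\<^sub>R B) = c *\<^sub>R (A ** B)"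
  for A :: "real^'n^'m" and B :: "real^'p^'n"
  by (simp add: matrix_matrix_mult_def vec_eq_iff sum_distrib_left mult.left_commute)

text \<open>Limits, continuity and the product rule for \<open>**\<close> become instances of the
  general facts on bounded bilinear maps.\<close>

lemma bounded_bilinear_matrix_matrix_mult:
  "bounded_bilinear ((**) :: real^'n^'m \<Rightarrow> real^'p^'n \<Rightarrow> real^'p^'m)"
  unfolding bilinear_conv_bounded_bilinear [symmetric] bilinear_def
  by (auto simp: matrix_matrix_mult_def vec_eq_iff distrib_left distrib_right sum.distrib
      sum_distrib_left mult_ac intro!: linearI)

lemma bounded_bilinear_matrix_vector_mult:
  "bounded_bilinear ((*v) :: real^'n^'m \<Rightarrow> real^'n \<Rightarrow> real^'m)"
  by (auto simp: bilinear_conv_bounded_bilinear [symmetric] bilinear_def matrix_vector_right_distrib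
      matrix_vector_mult_add_rdistrib scaleR_matrix_vector_assoc [symmetric] matrix_vector_mult_scaleR
      intro!: linearI)

lemmas matrix_mult_algebra =
  bounded_bilinear.add_left [OF bounded_bilinear_matrix_matrix_mult]
  bounded_bilinear.add_right [OF bounded_bilinear_matrix_matrix_mult]
  bounded_bilinear.diff_left [OF bounded_bilinear_matrix_matrix_mult]
  bounded_bilinear.diff_right [OF bounded_bilinear_matrix_matrix_mult]
  matrix_mult_scaleR_left matrix_mult_scaleR_right
lemmas tendsto_matrix_mult = bounded_bilinear.tendsto [OF bounded_bilinear_matrix_matrix_mult]
lemmas tendsto_matrix_vector_mult = bounded_bilinear.tendsto [OF bounded_bilinear_matrix_vector_mult]
lemmas continuous_on_matrix_mult =
  bounded_bilinear.continuous_on [OF bounded_bilinear_matrix_matrix_mult]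
lemmas continuous_on_matrix_vector_mult =
  bounded_bilinear.continuous_on [OF bounded_bilinear_matrix_vector_mult]

lemma bounded_linear_transpose: "bounded_linear (transpose :: real^'n^'m \<Rightarrow> real^'m^'n)"
  by (auto simp: linear_conv_bounded_linear [symmetric] transpose_def vec_eq_iff intro!: linearI)

section \<open>Matrix powers and convergence of the exponential series\<close>

lemma matrix_pow_0 [simp]: "matrix_pow A 0 = mat 1"
  by (simp add: matrix_pow_def)

lemma matrix_pow_Suc: "matrix_pow A (Suc k) = A ** matrix_pow A k"
  by (simp add: matrix_pow_def)

lemma matrix_pow_commute: "A ** matrix_pow A k = matrix_pow A k ** A"
proof (induction k)
  case (Suc k)
  have "A ** matrix_pow A (Suc k) = A ** (matrix_pow A k ** A)"
    using Suc by (simp add: matrix_pow_Suc)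
  then show ?case
    by (simp only: matrix_pow_Suc matrix_mul_assoc)
qed simp

lemma matrix_pow_transpose: "matrix_pow (transpose A) k = transpose (matrix_pow A k)"
proof (induction k)
  case (Suc k)
  then show ?case
    by (simp only: matrix_pow_Suc matrix_pow_commute [of A] matrix_transpose_mul)
qed simp

lemma matrix_pow_scaleR: "matrix_pow (t *\<^sub>R A) k = t ^ k *\<^sub>R matrix_pow A k"
  by (induction k) (simp_all add: matrix_pow_Suc matrix_mult_scaleR_left matrix_mult_scaleR_right mult.commute)

text \<open>Phrased through the action on vectors because the norm of \<open>real^'n^'n\<close> is
  Euclidean: \<open>mat 1\<close> has norm \<open>sqrt n\<close>, so the matrix norm can exceed
  \<open>K ^ k\<close> already at \<open>k = 0\<close>.\<close>

lemma matrix_pow_vector_bound: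
  fixes A :: "real^'n^'n"
  obtains K where "K > 0" "\<And>k x. norm (matrix_pow A k *v x) \<le> K ^ k * norm x"
proof -
  obtain K where K: "K > 0" "\<And>x. norm (A *v x) \<le> norm x * K"
    using bounded_linear.pos_bounded [OF matrix_vector_mul_bounded_linear [of A]] by blast
  have "norm (matrix_pow A k *v x) \<le> K ^ k * norm x" for k x
  proof (induction k)
    case (Suc k)
    have "norm (matrix_pow A (Suc k) *v x) \<le> norm (matrix_pow A k *v x) * K"
      using K(2) by (simp add: matrix_pow_Suc flip: matrix_vector_mul_assoc)
    also have "\<dots> \<le> K ^ k * norm x * K"
      using Suc K(1) by simp
    finally show ?case
      by (simp add: mult_ac)
  qed simp
  with K(1) that show thesis
    by blast
qed

text \<open>Comparison with the scalar exponential series at \<open>K * \<bar>t\<bar>\<close>.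
  Coefficient times \<open>t ^ k\<close> is the shape required for termwise differentiation.\<close>

lemma summable_matrix_pow_entry:
  fixes A :: "real^'n^'n"
  shows "summable (\<lambda>k. (matrix_pow A k $ i $ j / fact k) * t ^ k)"
proof -
  obtain K where K: "K > 0" "\<And>k x. norm (matrix_pow A k *v x) \<le> K ^ k * norm x"
    using matrix_pow_vector_bound [of A] by blast
  have entry: "\<bar>matrix_pow A k $ i $ j\<bar> \<le> K ^ k" for k
  proof -
    have "\<bar>(matrix_pow A k *v axis j 1) $ i\<bar> \<le> norm (matrix_pow A k *v axis j 1)"
      by (rule component_le_norm_cart)
    also have "\<dots> \<le> K ^ k"
      using K(2) [of k "axis j 1"] by simp
    finally show ?thesis
      by (simp add: matrix_vector_mult_basis column_def)
  qed
  have "norm ((matrix_pow A k $ i $ j / fact k) * t ^ k) \<le> (K * \<bar>t\<bar>) ^ k /\<^sub>R fact k" for k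
    using mult_right_mono [OF entry [of k], of "\<bar>t\<bar> ^ k"]
    by (simp add: abs_mult power_abs power_mult_distrib field_simps)
  then show ?thesis
    by (intro summable_comparison_test' [OF summable_exp_generic])
qed

text \<open>Entrywise convergence makes the series in the definition an actual sum, so that
  identities can be proved term by term.\<close>

lemma matrix_exp_sums:
  fixes A :: "real^'n^'n"
  shows "(\<lambda>k. (1 / fact k) *\<^sub>R matrix_pow A k) sums matrix_exp A"
proof -
  have "(\<lambda>k. (1 / fact k) *\<^sub>R matrix_pow A k) sums (\<chi> i j. \<Sum>k. matrix_pow A k $ i $ j / fact k)"
    unfolding sums_def
  proof (intro vec_tendstoI)
    fix i j
    have "(\<lambda>k. matrix_pow A k $ i $ j / fact k) sums (\<Sum>k. matrix_pow A k $ i $ j / fact k)"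
      using summable_matrix_pow_entry [of A i j 1] by (simp add: summable_sums)
    then show "(\<lambda>n. (\<Sum>k<n. (1 / fact k) *\<^sub>R matrix_pow A k) $ i $ j) \<longlonglongrightarrow>
        (\<chi> i j. \<Sum>k. matrix_pow A k $ i $ j / fact k) $ i $ j"
      by (simp add: sums_def)
  qed
  then show ?thesis
    by (simp add: matrix_exp_def sums_iff)
qed

lemma matrix_exp_entry:
  fixes A :: "real^'n^'n"
  shows "matrix_exp (t *\<^sub>R A) $ i $ j = (\<Sum>k. (matrix_pow A k $ i $ j / fact k) * t ^ k)"
proof -
  have "(\<lambda>k. ((1 / fact k) *\<^sub>R matrix_pow (t *\<^sub>R A) k) $ i $ j) sums matrix_exp (t *\<^sub>R A) $ i $ j"
    by (intro bounded_linear.sums [OF bounded_linear_vec_nth] matrix_exp_sums)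
  then show ?thesis
    by (simp add: sums_iff matrix_pow_scaleR mult.commute)
qed

lemma has_vector_derivative_vecI:
  fixes f :: "real \<Rightarrow> 'a::euclidean_space^'n"
  assumes "\<And>i. ((\<lambda>t. f t $ i) has_vector_derivative D $ i) (at t within S)"
  shows "(f has_vector_derivative D) (at t within S)"
  unfolding has_vector_derivative_def
proof (subst has_derivative_componentwise_within, intro ballI)
  fix b :: "'a^'n" assume "b \<in> Basis"
  then obtain i u where b: "b = axis i u"
    by (auto simp: Basis_vec_def)
  have "((\<lambda>t. f t $ i \<bullet> u) has_vector_derivative D $ i \<bullet> u) (at t within S)"
    using bounded_linear.has_vector_derivative [OF bounded_linear_inner_left assms] .
  then show "((\<lambda>x. f x \<bullet> b) has_derivative (\<lambda>x. x *\<^sub>R D \<bullet> b)) (at t within S)"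
    by (simp add: b inner_axis has_vector_derivative_def)
qed

text \<open>Each entry is an everywhere convergent power series in \<open>t\<close>, hence
  differentiable term by term.\<close>

lemma matrix_exp_has_vector_derivative:
  fixes A :: "real^'n^'n"
  shows "((\<lambda>t. matrix_exp (t *\<^sub>R A)) has_vector_derivative A ** matrix_exp (t *\<^sub>R A)) (at t within S)"
proof (intro has_vector_derivative_vecI)
  fix i j
  define c where "c = (\<lambda>i k. matrix_pow A k $ i $ j / fact k)"
  have sm: "summable (\<lambda>k. c l k * s ^ k)" for l s
    unfolding c_def by (rule summable_matrix_pow_entry)
  \<comment> \<open>The differentiated series has coefficients \<open>(k + 1) * c i (k + 1)\<close>;
    the factor \<open>k + 1\<close> cancels against the factorial.\<close>
  have "diffs (c i) k = (\<Sum>l\<in>UNIV. A $ i $ l * c l k)" for k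
  proof -
    have "diffs (c i) k = matrix_pow A (Suc k) $ i $ j / fact k"
      by (simp add: diffs_def c_def fact_Suc del: of_nat_Suc)
    then show ?thesis
      by (simp add: c_def matrix_pow_Suc matrix_matrix_mult_def sum_divide_distrib)
  qed
  then have "(\<Sum>k. diffs (c i) k * t ^ k) = (\<Sum>k. \<Sum>l\<in>UNIV. A $ i $ l * (c l k * t ^ k))"
    by (simp add: sum_distrib_left sum_distrib_right mult_ac)
  also have "\<dots> = (\<Sum>l\<in>UNIV. \<Sum>k. A $ i $ l * (c l k * t ^ k))"
    by (intro suminf_sum summable_mult sm)
  also have "\<dots> = (\<Sum>l\<in>UNIV. A $ i $ l * (\<Sum>k. c l k * t ^ k))"
    by (intro sum.cong refl suminf_mult sm)
  also have "\<dots> = (A ** matrix_exp (t *\<^sub>R A)) $ i $ j"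
    by (simp add: matrix_matrix_mult_def matrix_exp_entry c_def)
  finally have "DERIV (\<lambda>t. \<Sum>k. c i k * t ^ k) t :> (A ** matrix_exp (t *\<^sub>R A)) $ i $ j"
    using termdiffs_strong_converges_everywhere [OF sm, of i t] by simp
  then show "((\<lambda>t. matrix_exp (t *\<^sub>R A) $ i $ j) has_vector_derivative
      (A ** matrix_exp (t *\<^sub>R A)) $ i $ j) (at t within S)"
    by (simp add: matrix_exp_entry c_def has_real_derivative_iff_has_vector_derivative
        has_vector_derivative_at_within)
qed

lemma matrix_exp_0 [simp]: "matrix_exp 0 = (mat 1 :: real^'n^'n)"
proof -
  have "(1 / fact k) *\<^sub>R matrix_pow (0 :: real^'n^'n) k = (if k = 0 then mat 1 else 0)" for k
    by (cases k) (simp_all add: matrix_pow_Suc)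
  then show ?thesis
    using matrix_exp_sums [of "0 :: real^'n^'n"] sums_single [of 0 "\<lambda>_. mat 1 :: real^'n^'n"]
    by (simp add: sums_unique2)
qed

text \<open>Both products are sums of the same series, since \<open>A\<close> commutes with its
  powers.\<close>

lemma matrix_exp_commute:
  fixes A :: "real^'n^'n"
  shows "A ** matrix_exp (t *\<^sub>R A) = matrix_exp (t *\<^sub>R A) ** A"
proof (rule sums_unique2)
  have "matrix_pow (t *\<^sub>R A) k ** A = A ** matrix_pow (t *\<^sub>R A) k" for k
    by (simp add: matrix_pow_scaleR matrix_mult_scaleR_left matrix_mult_scaleR_right matrix_pow_commute)
  then show "(\<lambda>k. A ** ((1 / fact k) *\<^sub>R matrix_pow (t *\<^sub>R A) k)) sums (matrix_exp (t *\<^sub>R A) ** A)"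
    using bounded_linear.sums [OF bounded_bilinear.bounded_linear_left
        [OF bounded_bilinear_matrix_matrix_mult, of A] matrix_exp_sums [of "t *\<^sub>R A"]]
    by (simp add: matrix_mult_scaleR_left matrix_mult_scaleR_right)
  show "(\<lambda>k. A ** ((1 / fact k) *\<^sub>R matrix_pow (t *\<^sub>R A) k)) sums (A ** matrix_exp (t *\<^sub>R A))"
    by (intro bounded_linear.sums [OF bounded_bilinear.bounded_linear_right
        [OF bounded_bilinear_matrix_matrix_mult]] matrix_exp_sums)
qed

lemma matrix_exp_transpose:
  fixes A :: "real^'n^'n"
  shows "matrix_exp (transpose A) = transpose (matrix_exp A)"
proof (rule sums_unique2 [OF matrix_exp_sums])
  show "(\<lambda>k. (1 / fact k) *\<^sub>R matrix_pow (transpose A) k) sums transpose (matrix_exp A)"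
    using bounded_linear.sums [OF bounded_linear_transpose matrix_exp_sums [of A]]
    by (simp add: matrix_pow_transpose transpose_scalar)
qed

text \<open>The left side has derivative zero in \<open>t\<close>: the two terms of the product rule
  cancel once \<open>A\<close> is moved past the exponential. Its value at \<open>t = 0\<close> is
  the right side. Taking \<open>s = 0\<close> yields inverses; taking \<open>s + t\<close> and
  \<open>- t\<close> yields the semigroup law.\<close>

lemma matrix_exp_add_mult_minus:
  fixes A :: "real^'n^'n"
  shows "matrix_exp ((s + t) *\<^sub>R A) ** matrix_exp ((- t) *\<^sub>R A) = matrix_exp (s *\<^sub>R A)"
proof -
  let ?E = "\<lambda>t. matrix_exp (t *\<^sub>R A)"
  let ?f = "\<lambda>t. ?E (s + t) ** ?E (- t)"
  have "(?f has_vector_derivative 0) (at t)" for t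
  proof -
    have "((\<lambda>t. ?E (- t)) has_vector_derivative (- 1) *\<^sub>R (A ** ?E (- t))) (at t)"
      using vector_diff_chain_at [of uminus "-1" t ?E] matrix_exp_has_vector_derivative [of A "- t"]
      by (simp add: o_def has_vector_derivative_minus has_vector_derivative_id
         has_vector_derivative_def)
    moreover have "((\<lambda>t. s + t) has_vector_derivative 1) (at t)"
      by (auto intro!: derivative_eq_intros)
    then have "((\<lambda>t. ?E (s + t)) has_vector_derivative A ** ?E (s + t)) (at t)"
      using vector_diff_chain_at [of "\<lambda>t. s + t" 1 t ?E]
        matrix_exp_has_vector_derivative [of A "s + t"] by (simp add: o_def)
    ultimately have "(?f has_vector_derivative
        ?E (s + t) ** ((- 1) *\<^sub>R (A ** ?E (- t))) + (A ** ?E (s + t)) ** ?E (- t)) (at t)"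
      by (intro bounded_bilinear.has_vector_derivative [OF bounded_bilinear_matrix_matrix_mult])
    then show ?thesis
      by (simp only: matrix_exp_commute [of A "s + t"] matrix_mult_scaleR_right matrix_mul_assoc) simp
  qed
  then obtain c where "\<And>t. ?f t = c"
    using has_vector_derivative_zero_constant [of UNIV ?f] by auto
  then have "?f t = ?f 0"
    by metis
  then show ?thesis
    by simp
qed

lemma matrix_exp_mult_minus:
  fixes A :: "real^'n^'n"
  shows "matrix_exp (t *\<^sub>R A) ** matrix_exp ((- t) *\<^sub>R A) = mat 1"
  using matrix_exp_add_mult_minus [of 0 t A] by simp

lemma matrix_exp_add:
  fixes A :: "real^'n^'n"
  shows "matrix_exp ((s + t) *\<^sub>R A) = matrix_exp (s *\<^sub>R A) ** matrix_exp (t *\<^sub>R A)"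
  using matrix_exp_add_mult_minus [of "s + t" "- t" A] by simp

lemma continuous_on_matrix_exp: "continuous_on S (\<lambda>t. matrix_exp (t *\<^sub>R A))"
  for A :: "real^'n^'n"
  by (rule continuous_on_vector_derivative [OF matrix_exp_has_vector_derivative])

lemma continuous_on_matrix_exp_minus: "continuous_on S (\<lambda>t. matrix_exp ((- t) *\<^sub>R A))"
  for A :: "real^'n^'n"
  by (rule continuous_on_compose2 [OF continuous_on_matrix_exp [of UNIV A]])
     (simp_all add: continuous_on_minus)

lemma matrix_exp_vector_has_vector_derivative:
  fixes A :: "real^'n^'n"
  shows "((\<lambda>t. matrix_exp (t *\<^sub>R A) *v x) has_vector_derivative A *v (matrix_exp (t *\<^sub>R A) *v x))
    (at t within S)"
  using bounded_linear.has_vector_derivative [OF bounded_bilinear.bounded_linear_left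
      [OF bounded_bilinear_matrix_vector_mult] matrix_exp_has_vector_derivative [of A t S]]
  by (simp add: matrix_vector_mul_assoc)

lemma matrix_exp_vector_sums:
  fixes A :: "real^'n^'n"
  shows "(\<lambda>k. (t ^ k / fact k) *\<^sub>R (matrix_pow A k *v x)) sums (matrix_exp (t *\<^sub>R A) *v x)"
  using bounded_linear.sums [OF bounded_bilinear.bounded_linear_left
      [OF bounded_bilinear_matrix_vector_mult] matrix_exp_sums [of "t *\<^sub>R A"], of x]
  by (simp add: matrix_pow_scaleR flip: scaleR_matrix_vector_assoc)

section \<open>Trajectories, observability and controllability\<close>

text \<open>The largest \<open>A\<close>-invariant subspace inside the kernel of \<open>C\<close>,
  expressed by the Taylor coefficients of the free output at time 0.\<close>

definition unobservable_space :: "real^'n^'n \<Rightarrow> real^'n^'q \<Rightarrow> (real^'n) set" where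
  "unobservable_space A C = {x. \<forall>k. C *v (matrix_pow A k *v x) = 0}"

lemma zero_in_unobservable_space: "0 \<in> unobservable_space A C"
  by (simp add: unobservable_space_def)

lemma unobservable_space_output_zero:
  assumes "x \<in> unobservable_space A C"
  shows "C *v (matrix_exp (t *\<^sub>R A) *v x) = 0"
proof -
  have "(\<lambda>k. C *v ((t ^ k / fact k) *\<^sub>R (matrix_pow A k *v x))) sums
      (C *v (matrix_exp (t *\<^sub>R A) *v x))"
    by (intro bounded_linear.sums [OF matrix_vector_mul_bounded_linear] matrix_exp_vector_sums)
  then show ?thesis
    using assms by (simp add: unobservable_space_def matrix_vector_mult_scaleR sums_unique2 [OF _ sums_zero])
qed

text \<open>Differentiating the vanishing output \<open>k\<close> times and evaluating at 0 isolates
  the condition for the power \<open>k\<close>. Since \<open>T > 0\<close>, derivatives within the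
  closed interval are unique even at its end points.\<close>

lemma output_zero_unobservable_space:
  assumes "T > 0" and "\<And>t. t \<in> {0..T} \<Longrightarrow> C *v (matrix_exp (t *\<^sub>R A) *v x) = 0"
  shows "x \<in> unobservable_space A C"
proof -
  have "\<forall>t\<in>{0..T}. C *v (matrix_exp (t *\<^sub>R A) *v (matrix_pow A k *v x)) = 0" for k
  proof (induction k)
    case (Suc k)
    show ?case
    proof
      fix t assume t: "t \<in> {0..T}"
      let ?y = "\<lambda>t. C *v (matrix_exp (t *\<^sub>R A) *v (matrix_pow A k *v x))"
      have "(?y has_vector_derivative
          C *v (A *v (matrix_exp (t *\<^sub>R A) *v (matrix_pow A k *v x)))) (at t within {0..T})"
        by (intro bounded_linear.has_vector_derivative [OF matrix_vector_mul_bounded_linear]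
            matrix_exp_vector_has_vector_derivative)
      moreover have "(?y has_vector_derivative 0) (at t within {0..T})"
        by (rule has_vector_derivative_transform [OF t _ has_vector_derivative_const]) (use Suc in auto)
      ultimately have "C *v (A *v (matrix_exp (t *\<^sub>R A) *v (matrix_pow A k *v x))) = 0"
        using vector_derivative_unique_within_closed_interval [OF \<open>T > 0\<close>] t
        by (metis box_real(2))
      then show "C *v (matrix_exp (t *\<^sub>R A) *v (matrix_pow A (Suc k) *v x)) = 0"
        by (simp add: matrix_vector_mul_assoc matrix_pow_Suc matrix_mul_assoc
            flip: matrix_exp_commute)
    qed
  qed (use assms in simp)
  from this [THEN bspec, of 0] show ?thesis
    using \<open>T > 0\<close> by (simp add: unobservable_space_def)
qed

text \<open>The integral equation exhibits \<open>x\<close> as an indefinite integral. Continuity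
  supplies the initial bound for the iteration that follows.\<close>

lemma trajectory_continuous:
  assumes "trajectory A B T u x"
  shows "continuous_on {0..T} x"
proof (cases "T \<ge> 0")
  case True
  let ?g = "\<lambda>s. A *v x s + B *v u s"
  have g: "(?g has_integral (x t - x 0)) {0..t}" if "t \<in> {0..T}" for t
    using assms that by (simp add: trajectory_def)
  have "continuous_on {0..T} (\<lambda>t. x 0 + integral {0..t} ?g)"
    using g [of T] True by (intro continuous_intros indefinite_integral_continuous_1) auto
  moreover have "x 0 + integral {0..t} ?g = x t" if "t \<in> {0..T}" for t
    using integral_unique [OF g [OF that]] by simp
  ultimately show ?thesis
    by (metis (no_types, lifting) continuous_on_eq)
qed simp

text \<open>The functions \<open>z\<^sub>k \<bullet> x\<close> with \<open>z\<^sub>k = (A\<^sup>T)\<^sup>k z\<close> are successive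
  antiderivatives of each other, since the input term drops out. Iterating the trivial bound on
  them yields \<open>\<bar>z \<bullet> x t\<bar> \<le> c (K t)\<^sup>j / j!\<close> for every \<open>j\<close>.\<close>

lemma trajectory_orthogonal:
  fixes A :: "real^'n^'n" and B :: "real^'p^'n"
  assumes tr: "trajectory A B T u x" and x0: "x 0 = 0" and t: "t \<in> {0..T}"
    and z: "z \<in> unobservable_space (transpose A) (transpose B)"
  shows "z \<bullet> x t = 0"
proof -
  define w where "w k = matrix_pow (transpose A) k *v z" for k
  obtain K where K: "K > 0" "\<And>k. norm (w k) \<le> K ^ k * norm z"
    using matrix_pow_vector_bound [of "transpose A"] unfolding w_def by metis
  have "bounded (x ` {0..T})"
    by (intro compact_imp_bounded compact_continuous_image trajectory_continuous [OF tr] compact_Icc)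
  then obtain D where D: "D > 0" "\<forall>y\<in>x ` {0..T}. norm y \<le> D"
    by (auto simp: bounded_pos)
  have int: "((\<lambda>r. w (Suc k) \<bullet> x r) has_integral w k \<bullet> x s) {0..s}" if "s \<in> {0..T}" for k s
  proof -
    have "((\<lambda>r. A *v x r + B *v u r) has_integral (x s - x 0)) {0..s}"
      using tr that by (simp add: trajectory_def)
    from has_integral_linear [OF this bounded_linear_inner_right [of "w k"]]
    have "((\<lambda>r. w k \<bullet> (A *v x r + B *v u r)) has_integral w k \<bullet> (x s - x 0)) {0..s}"
      by (simp only: o_def)
    moreover have "w k \<bullet> (A *v y + B *v v) = w (Suc k) \<bullet> y" for y v
    proof -
      have "w k v* B = 0"
        using z by (simp add: w_def unobservable_space_def)
      moreover have "w (Suc k) = w k v* A"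
        by (simp add: w_def matrix_pow_Suc flip: matrix_vector_mul_assoc)
      ultimately show ?thesis
        by (simp add: inner_add_right flip: dot_lmul_matrix)
    qed
    ultimately show ?thesis
      by (simp add: x0)
  qed
  define c where "c = norm z * D"
  \<comment> \<open>All \<open>k\<close> are treated at once because the bound of order
    \<open>Suc j\<close> for \<open>w k\<close> integrates the bound of order \<open>j\<close> for
    \<open>w (Suc k)\<close>.\<close>
  have bound: "\<forall>k. \<forall>s\<in>{0..T}. \<bar>w k \<bullet> x s\<bar> \<le> c * K ^ (k + j) * s ^ j / fact j" for j
  proof (induction j)
    case 0
    show ?case
    proof (intro allI ballI)
      fix k s assume "s \<in> {0..T}"
      then have "\<bar>w k \<bullet> x s\<bar> \<le> (K ^ k * norm z) * D"
        using K D(1) D(2)[rule_format, of "x s"] by (intro order_trans [OF Cauchy_Schwarz_ineq2] mult_mono) auto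
      then show "\<bar>w k \<bullet> x s\<bar> \<le> c * K ^ (k + 0) * s ^ 0 / fact 0"
        by (simp add: c_def mult_ac)
    qed
  next
    case (Suc j)
    show ?case
    proof (intro allI ballI)
      fix k s assume s: "s \<in> {0..T}"
      let ?M = "c * K ^ (k + Suc j)"
      have M: "((\<lambda>r. ?M * r ^ j / fact j) has_integral
          ?M * s ^ Suc j / fact (Suc j) - ?M * 0 ^ Suc j / fact (Suc j)) {0..s}"
      proof (rule fundamental_theorem_of_calculus)
        fix r
        have "((\<lambda>r. ?M * r ^ Suc j / fact (Suc j)) has_real_derivative
            ?M * (real (Suc j) * r ^ j) / fact (Suc j)) (at r within {0..s})"
          by (intro DERIV_cdivide DERIV_cmult) (use DERIV_power_Suc [OF DERIV_ident] in simp)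
        then show "((\<lambda>r. ?M * r ^ Suc j / fact (Suc j)) has_vector_derivative ?M * r ^ j / fact j)
            (at r within {0..s})"
          by (simp add: fact_Suc has_real_derivative_iff_has_vector_derivative mult.assoc del: of_nat_Suc power_Suc)
      qed (use s in auto)
      have "norm (integral {0..s} (\<lambda>r. w (Suc k) \<bullet> x r)) \<le> integral {0..s} (\<lambda>r. ?M * r ^ j / fact j)"
        using Suc.IH s
        by (intro integral_norm_bound_integral has_integral_integrable [OF int [OF s, of k]]
            has_integral_integrable [OF M]) (auto dest: spec [of _ "Suc k"])
      also have "\<dots> = ?M * s ^ Suc j / fact (Suc j)"
        using integral_unique [OF M] by simp
      finally show "\<bar>w k \<bullet> x s\<bar> \<le> ?M * s ^ Suc j / fact (Suc j)"
        using integral_unique [OF int [OF s, of k]] by simp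
    qed
  qed
  have "\<bar>z \<bullet> x t\<bar> \<le> c * ((K * t) ^ j /\<^sub>R fact j)" for j
    using bound [of j, rule_format, OF t, of 0]
    by (simp add: w_def power_mult_distrib field_simps)
  moreover have "(\<lambda>j. c * ((K * t) ^ j /\<^sub>R fact j)) \<longlonglongrightarrow> c * 0"
    by (intro tendsto_mult_left summable_LIMSEQ_zero summable_exp_generic)
  ultimately have "\<bar>z \<bullet> x t\<bar> \<le> c * 0"
    by (meson LIMSEQ_le_const)
  then show ?thesis
    by simp
qed

text \<open>Classical solutions satisfy the integral equation by the fundamental theorem of
  calculus.\<close>

lemma trajectoryI:
  fixes A :: "real^'n^'n" and B :: "real^'p^'n"
  assumes "continuous_on {0..T} u"
    and "\<And>t. t \<in> {0..T} \<Longrightarrow> (x has_vector_derivative A *v x t + B *v u t) (at t within {0..T})"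
  shows "trajectory A B T u x"
  unfolding trajectory_def
proof (intro conjI ballI)
  show "u absolutely_integrable_on {0..T}"
    using assms(1) by (rule absolutely_integrable_continuous_real)
  fix t assume "t \<in> {0..T}"
  then show "((\<lambda>s. A *v x s + B *v u s) has_integral x t - x 0) {0..t}"
    by (intro fundamental_theorem_of_calculus)
       (auto intro: has_vector_derivative_within_subset [OF assms(2)])
qed

lemma trajectory_matrix_exp:
  "trajectory A B T (\<lambda>_. 0) (\<lambda>t. matrix_exp (t *\<^sub>R A) *v x)"
  by (rule trajectoryI) (simp_all add: matrix_exp_vector_has_vector_derivative)

text \<open>Uniqueness of solutions. The error \<open>d\<close> solves the homogeneous equation with
  \<open>d 0 = 0\<close>. For the zero input matrix every vector lies in the dual unobservable
  space, so \<open>trajectory_orthogonal\<close> applies with \<open>z = d t\<close> and gives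
  \<open>d t \<bullet> d t = 0\<close>.\<close>

lemma trajectory_diff:
  fixes A :: "real^'n^'n" and B :: "real^'p^'n"
  assumes x: "trajectory A B T u x" and y: "trajectory A B T u y" and t: "t \<in> {0..T}"
  shows "x t - y t = matrix_exp (t *\<^sub>R A) *v (x 0 - y 0)"
proof -
  define e where "e = (\<lambda>t. matrix_exp (t *\<^sub>R A) *v (x 0 - y 0))"
  define d where "d = (\<lambda>t. x t - y t - e t)"
  have "trajectory A (0 :: real^'p^'n) T (\<lambda>_. 0) d"
    unfolding trajectory_def
  proof (intro conjI ballI)
    fix s assume s: "s \<in> {0..T}"
    have "((\<lambda>s. (A *v x s + B *v u s) - (A *v y s + B *v u s) - (A *v e s + B *v 0)) has_integral
        (x s - x 0) - (y s - y 0) - (e s - e 0)) {0..s}"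
      using x y trajectory_matrix_exp [of A B T "x 0 - y 0"] s unfolding e_def trajectory_def
      by (intro has_integral_diff) auto
    then show "((\<lambda>s. A *v d s + 0 *v 0) has_integral (d s - d 0)) {0..s}"
      by (simp add: d_def e_def matrix_vector_mult_diff_distrib algebra_simps)
  qed simp
  moreover have "d 0 = 0"
    by (simp add: d_def e_def)
  ultimately have "d t \<bullet> d t = 0"
    by (rule trajectory_orthogonal [OF _ _ t]) (simp add: unobservable_space_def)
  then show ?thesis
    by (simp add: d_def e_def)
qed

text \<open>The difference of two trajectories with a common input is a free motion, so only free
  outputs matter. An unobservable \<open>x\<close> is compared with the initial state 0; conversely
  any positive horizon would do, and 1 is chosen.\<close>

lemma observable_iff_unobservable_space:
  fixes A :: "real^'n^'n" and B :: "real^'p^'n" and C :: "real^'n^'q"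
  shows "observable A B C \<longleftrightarrow> unobservable_space A C = {0}"
proof
  assume "observable A B C"
  then obtain T where T: "\<forall>u x x'. trajectory A B T u x \<and> trajectory A B T u x' \<and>
        (\<forall>t\<in>{0..T}. C *v x t = C *v x' t) \<longrightarrow> x 0 = x' 0"
    unfolding observable_def by (elim exE conjE)
  have "x = 0" if "x \<in> unobservable_space A C" for x
    using T [rule_format, OF conjI [OF trajectory_matrix_exp [of A B T x]
          conjI [OF trajectory_matrix_exp [of A B T 0]]]] that
    by (simp add: unobservable_space_output_zero)
  then show "unobservable_space A C = {0}"
    using zero_in_unobservable_space by blast
next
  assume U: "unobservable_space A C = {0}"
  show "observable A B C"
    unfolding observable_def
  proof (intro exI [of _ 1] conjI allI impI; (elim conjE)?)
    fix u :: "real \<Rightarrow> real^'p" and x x' :: "real \<Rightarrow> real^'n"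
    assume tr: "trajectory A B 1 u x" "trajectory A B 1 u x'"
      and out: "\<forall>t\<in>{0..1}. C *v x t = C *v x' t"
    have "C *v (matrix_exp (t *\<^sub>R A) *v (x 0 - x' 0)) = 0" if "t \<in> {0..1}" for t
      using out that unfolding trajectory_diff [OF tr that, symmetric]
      by (simp add: matrix_vector_mult_diff_distrib)
    then have "x 0 - x' 0 \<in> unobservable_space A C"
      by (intro output_zero_unobservable_space [of 1]) auto
    with U show "x 0 = x' 0"
      by simp
  qed simp
qed

text \<open>By the product rule; in the term from the integral, the exponentials at \<open>t\<close>
  and \<open>- t\<close> cancel and leave \<open>B *v u t\<close>.\<close>

lemma variation_of_constants:
  fixes A :: "real^'n^'n" and B :: "real^'p^'n"
  assumes u: "continuous_on {0..T} u"
  shows "trajectory A B T u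
    (\<lambda>t. matrix_exp (t *\<^sub>R A) *v (x0 + integral {0..t} (\<lambda>s. matrix_exp ((- s) *\<^sub>R A) *v (B *v u s))))"
proof (rule trajectoryI [OF u])
  let ?E = "\<lambda>t. matrix_exp (t *\<^sub>R A)"
  let ?g = "\<lambda>s. ?E (- s) *v (B *v u s)"
  fix t assume t: "t \<in> {0..T}"
  have "continuous_on {0..T} ?g"
    by (intro continuous_on_matrix_vector_mult continuous_on_matrix_exp_minus u continuous_on_const)
  then have "((\<lambda>t. x0 + integral {0..t} ?g) has_vector_derivative ?g t) (at t within {0..T})"
    using t integral_has_vector_derivative by (auto intro!: derivative_eq_intros)
  then have "((\<lambda>t. ?E t *v (x0 + integral {0..t} ?g)) has_vector_derivative
      ?E t *v ?g t + (A ** ?E t) *v (x0 + integral {0..t} ?g)) (at t within {0..T})"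
    by (intro bounded_bilinear.has_vector_derivative [OF bounded_bilinear_matrix_vector_mult]
        matrix_exp_has_vector_derivative)
  moreover have "?E t *v ?g t = B *v u t"
    using matrix_exp_mult_minus [of t A] by (simp add: matrix_vector_mul_assoc matrix_mul_assoc)
  ultimately show "((\<lambda>t. ?E t *v (x0 + integral {0..t} ?g)) has_vector_derivative
      A *v (?E t *v (x0 + integral {0..t} ?g)) + B *v u t) (at t within {0..T})"
    by (simp add: matrix_vector_mul_assoc add.commute)
qed

text \<open>States reached from 0 are orthogonal to the dual unobservable space, so steering to one
  of its elements \<open>z\<close> forces \<open>z \<bullet> z = 0\<close>. Conversely, a nonzero
  vector orthogonal to all reachable directions produces a nonzero element of that space.\<close>

lemma controllable_iff_unobservable_space:
  fixes A :: "real^'n^'n" and B :: "real^'p^'n"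
  shows "controllable A B \<longleftrightarrow> unobservable_space (transpose A) (transpose B) = {0}"
proof
  assume con: "controllable A B"
  have "z = 0" if "z \<in> unobservable_space (transpose A) (transpose B)" for z
  proof -
    obtain T u x where "T > 0" "trajectory A B T u x" "x 0 = 0" "x T = z"
      using con unfolding controllable_def by metis
    then show ?thesis
      using trajectory_orthogonal [of A B T u x T z] that by simp
  qed
  then show "unobservable_space (transpose A) (transpose B) = {0}"
    using zero_in_unobservable_space by blast
next
  assume U: "unobservable_space (transpose A) (transpose B) = {0}"
  let ?E = "\<lambda>t. matrix_exp (t *\<^sub>R A)"
  let ?g = "\<lambda>u s. ?E (- s) *v (B *v u s)"
  \<comment> \<open>The states reached from 0 at time 1, transported back to time 0 by
    \<open>?E (- 1)\<close>.\<close>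
  define R where "R = (\<lambda>u. integral {0..1} (?g u)) ` {u. continuous_on {0..1} u}"
  have cont: "continuous_on {0..1} (?g u)" if "continuous_on {0..1} u" for u
    by (intro continuous_on_matrix_vector_mult continuous_on_matrix_exp_minus that continuous_on_const)
  note int = integrable_continuous_interval [OF cont]
  have sub: "subspace R"
  proof (rule subspaceI)
    show "0 \<in> R"
      unfolding R_def by (rule image_eqI [of _ _ "\<lambda>_. 0"]) simp_all
  next
    fix a b assume "a \<in> R" "b \<in> R"
    then obtain u v where uv: "continuous_on {0..1} u" "continuous_on {0..1} v"
      and ab: "a = integral {0..1} (?g u)" "b = integral {0..1} (?g v)"
      by (auto simp: R_def)
    have "a + b = integral {0..1} (?g (\<lambda>s. u s + v s))"
      unfolding ab by (simp only: matrix_vector_right_distrib integral_add [OF int int] uv)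
    then show "a + b \<in> R"
      using uv by (auto simp: R_def intro!: continuous_on_add continuous_on_scaleR)
  next
    fix c a assume "a \<in> R"
    then obtain u where u: "continuous_on {0..1} u" "a = integral {0..1} (?g u)"
      by (auto simp: R_def)
    have "c *\<^sub>R a = integral {0..1} (?g (\<lambda>s. c *\<^sub>R u s))"
      by (simp add: u matrix_vector_mult_scaleR)
    then show "c *\<^sub>R a \<in> R"
      using u by (auto simp: R_def intro!: continuous_on_add continuous_on_scaleR)
  qed
  have "R = UNIV"
  proof (rule ccontr)
    assume "R \<noteq> UNIV"
    then obtain w where w: "w \<noteq> 0" "\<And>x. x \<in> R \<Longrightarrow> w \<bullet> x = 0"
      using span_not_UNIV_orthogonal [of R] sub span_eq_iff [of R] by metis
    define z where "z = transpose (?E (- 1)) *v w"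
    \<comment> \<open>The input is chosen so that \<open>w \<bullet> ?g u s\<close> becomes the
      square \<open>u s \<bullet> u s\<close>.\<close>
    define u where "u = (\<lambda>s. transpose B *v (transpose (?E (- s)) *v w))"
    have cu: "continuous_on {0..1} u"
      unfolding u_def
      by (intro continuous_on_matrix_vector_mult continuous_on_const
          bounded_linear.continuous_on [OF bounded_linear_transpose] continuous_on_matrix_exp_minus)
    have "((\<lambda>s. w \<bullet> ?g u s) has_integral w \<bullet> integral {0..1} (?g u)) {0..1}"
      using has_integral_linear [OF integrable_integral [OF int [OF cu]] bounded_linear_inner_right]
      by (simp add: o_def)
    moreover have "w \<bullet> integral {0..1} (?g u) = 0"
      using cu by (intro w) (auto simp: R_def)
    moreover have "w \<bullet> ?g u s = u s \<bullet> u s" for s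
      by (simp add: u_def flip: dot_lmul_matrix)
    ultimately have "((\<lambda>s. u s \<bullet> u s) has_integral 0) (cbox 0 1)"
      by simp
    then have u0: "u s = 0" if "s \<in> {0..1}" for s
      using has_integral_0_cbox_imp_0 [of 0 1 "\<lambda>s. u s \<bullet> u s" s] cu that
      by (auto intro!: continuous_intros)
    have "z \<in> unobservable_space (transpose A) (transpose B)"
    proof (rule output_zero_unobservable_space)
      fix t :: real assume "t \<in> {0..1}"
      \<comment> \<open>Time reversal: after transposing, \<open>u (1 - t)\<close> is the output of
        the dual system started at \<open>z\<close>.\<close>
      have "?E (- (1 - t)) = ?E (- 1) ** ?E t"
        using matrix_exp_add [of "- 1" t A] by simp
      then have "transpose B *v (matrix_exp (t *\<^sub>R transpose A) *v z) = u (1 - t)"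
        by (simp only: u_def z_def transpose_scalar [symmetric] matrix_exp_transpose matrix_transpose_mul
            matrix_vector_mul_assoc)
      then show "transpose B *v (matrix_exp (t *\<^sub>R transpose A) *v z) = 0"
        using u0 [of "1 - t"] \<open>t \<in> {0..1}\<close> by simp
    qed simp
    then have "transpose (?E 1) *v z = 0"
      using U by simp
    moreover have "transpose (?E 1) *v z = w"
      using matrix_exp_mult_minus [of "- 1" A]
      by (simp only: z_def matrix_vector_mul_assoc flip: matrix_transpose_mul) (simp add: transpose_mat)
    ultimately show False
      using w by simp
  qed
  show "controllable A B"
    unfolding controllable_def
  proof (intro allI)
    fix x0 x1 :: "real^'n"
    \<comment> \<open>The equation \<open>x 1 = x1\<close> of the variation of constants formula,
      solved for the integral.\<close>
    obtain u where u: "continuous_on {0..1} u" "?E (- 1) *v x1 - x0 = integral {0..1} (?g u)"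
      using \<open>R = UNIV\<close> unfolding R_def by blast
    define x where "x = (\<lambda>t. ?E t *v (x0 + integral {0..t} (?g u)))"
    have "x 0 = x0"
      by (simp add: x_def)
    moreover have "x 1 = ?E 1 *v (?E (- 1) *v x1)"
      by (simp only: x_def flip: u(2)) simp
    then have "x 1 = x1"
      using matrix_exp_mult_minus [of 1 A] by (simp only: matrix_vector_mul_assoc) simp
    moreover have "trajectory A B 1 u x"
      unfolding x_def by (rule variation_of_constants [OF u(1)])
    ultimately show "\<exists>T>0. \<exists>u x. trajectory A B T u x \<and> x 0 = x0 \<and> x T = x1"
      using zero_less_one by blast
  qed
qed

section \<open>Multiplicity of the eigenvalue zero\<close>

text \<open>The kernel is the orthogonal complement of the range of the transpose, whose dimension
  is also the rank.\<close>

lemma rank_plus_dim_kernel: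
  fixes M :: "real^'n^'m"
  shows "rank M + dim {x. M *v x = 0} = CARD('n)"
proof -
  have "subspace (range ((*v) (transpose M)))"
    by (intro linear_subspace_image) auto
  then have "dim {y \<in> UNIV. \<forall>x \<in> range ((*v) (transpose M)). orthogonal x y}
      + dim (range ((*v) (transpose M))) = dim (UNIV :: (real^'n) set)"
    by (intro dim_subspace_orthogonal_to_vectors) auto
  moreover have "(\<forall>x \<in> range ((*v) (transpose M)). orthogonal x y) \<longleftrightarrow> M *v y = 0" for y
    by (auto simp: orthogonal_def dot_lmul_matrix) (metis inner_eq_zero_iff)
  moreover have "dim (range ((*v) (transpose M))) = rank M"
    by (metis rank_dim_range rank_transpose)
  ultimately show ?thesis
    by simp
qed

lemma subspace_matrix_kernel: "subspace {x. (M :: real^'n^'m) *v x = 0}"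
  by (intro linear_subspace_kernel) simp

lemma poly_det: "poly (det P) s = det (\<chi> i j. poly (P $ i $ j) s)"
  for P :: "real poly^'n^'n"
  by (simp add: det_def poly_sum poly_prod of_int_poly)

lemma poly_char_polynomial: "poly (char_polynomial A) s = det (s *\<^sub>R mat 1 - A)"
  unfolding char_polynomial_def poly_det
  by (intro arg_cong [where f = det]) (simp add: vec_eq_iff mat_def map_matrix_def)

text \<open>In a basis consisting of fixed points and of kernel vectors of the projection, the matrix
  is diagonal with entries \<open>s\<close> and \<open>1\<close>.\<close>

lemma det_projection:
  fixes J :: "real^'n^'n"
  assumes J: "J ** J = J"
  shows "det (mat 1 + (s - 1) *\<^sub>R J) = s ^ rank J"
proof -
  have JJ: "J *v (J *v x) = J *v x" for x
    by (simp add: matrix_vector_mul_assoc J)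
  obtain S where S: "S \<subseteq> range ((*v) J)" "independent S" "range ((*v) J) \<subseteq> span S" "card S = rank J"
    using basis_exists [of "range ((*v) J)"] by (metis rank_dim_range)
  obtain T where T: "T \<subseteq> {x. J *v x = 0}" "independent T" "{x. J *v x = 0} \<subseteq> span T"
      "card T = dim {x. J *v x = 0}"
    using basis_exists by metis
  have fin: "finite S" "finite T"
    using S T by (simp_all add: independent_imp_finite)
  have fixS: "J *v x = x" if "x \<in> S" for x
    using S(1) that JJ by auto
  have span: "span (S \<union> T) = UNIV"
  proof (rule UNIV_eq_I [symmetric])
    fix x
    have "J *v x \<in> span (S \<union> T)"
      using S(3) span_mono [of S "S \<union> T"] by blast
    moreover have "x - J *v x \<in> {x. J *v x = 0}"
      by (simp add: matrix_vector_mult_diff_distrib JJ)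
    then have "x - J *v x \<in> span (S \<union> T)"
      using T(3) span_mono [of T "S \<union> T"] by blast
    ultimately have "J *v x + (x - J *v x) \<in> span (S \<union> T)"
      by (rule span_add)
    then show "x \<in> span (S \<union> T)"
      by simp
  qed
  have "card (S \<union> T) \<le> CARD('n)"
    using card_Un_le [of S T] S(4) T(4) rank_plus_dim_kernel [of J] by simp
  moreover have "CARD('n) \<le> card (S \<union> T)"
    using dim_le_card [of "UNIV :: (real^'n) set" "S \<union> T"] span fin by simp
  \<comment> \<open>A spanning set of at most \<open>CARD('n)\<close> vectors has exactly that many,
    so the basis can be indexed by \<open>'n\<close>.\<close>
  ultimately obtain f :: "'n \<Rightarrow> real^'n" where f: "bij_betw f UNIV (S \<union> T)"
    using finite_same_card_bij [of "UNIV :: 'n set" "S \<union> T"] fin by fastforce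
  \<comment> \<open>The basis vectors are the rows, so right multiplication by
    \<open>transpose M\<close> scales row \<open>i\<close> by \<open>c i\<close> and
    \<open>det P\<close> cancels.\<close>
  define P where "P = (\<chi> i. f i)"
  define M where "M = mat 1 + (s - 1) *\<^sub>R J"
  define c where "c i = (if f i \<in> S then s else 1)" for i
  have "rows P = S \<union> T"
    using f by (auto simp: P_def rows_def row_def bij_betw_def)
  then have detP: "det P \<noteq> 0"
    using span unfolding invertible_det_nz [symmetric] invertible_left_inverse
    by (simp add: matrix_left_invertible_span_rows)
  have "M *v f i = c i *s f i" for i
  proof -
    have "J *v f i = (if f i \<in> S then f i else 0)"
      using f fixS T(1) by (auto simp: bij_betw_def)
    then show ?thesis
      by (simp add: M_def c_def matrix_vector_mult_add_rdistrib scaleR_matrix_vector_assoc [symmetric]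
          scalar_mult_eq_scaleR algebra_simps)
  qed
  moreover have "(P ** transpose M) $ i = M *v f i" for i
    by (simp add: P_def vec_eq_iff matrix_matrix_mult_def matrix_vector_mult_def transpose_def mult.commute)
  ultimately have "P ** transpose M = (\<chi> i. c i *s f i)"
    by (simp add: vec_eq_iff)
  then have "det P * det M = prod c UNIV * det P"
    by (metis P_def det_mul det_rows_mul det_transpose)
  then have "det M = prod c UNIV"
    using detP by simp
  also have "prod c UNIV = s ^ card {i. f i \<in> S}"
    by (simp add: c_def prod.If_cases)
  also have "card {i. f i \<in> S} = card S"
  proof (rule bij_betw_same_card)
    show "bij_betw f {i. f i \<in> S} S"
      using f by (auto simp: bij_betw_def inj_on_def image_iff set_eq_iff) blast
  qed
  finally show ?thesis
    by (simp add: M_def S(4))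
qed

text \<open>Since \<open>J A = A J = 0\<close> and \<open>J\<^sup>2 = J\<close>, the factorization
  \<open>s I - A = (I + (s - 1) J) (s I - A + (1 - s) J)\<close> splits off the power \<open>s\<^bsup>rank J\<^esup>\<close>, and the second
  factor is the invertible matrix \<open>J - A\<close> at \<open>s = 0\<close>.\<close>

lemma algebraic_multiplicity_0_eq_rank:
  fixes A J :: "real^'n^'n"
  assumes AJ: "A ** J = 0" and JA: "J ** A = 0" and JJ: "J ** J = J"
    and ker: "\<And>x. A *v x = 0 \<Longrightarrow> J *v x = x"
  shows "algebraic_multiplicity A 0 = rank J"
proof -
  let ?N = "\<lambda>s. s *\<^sub>R mat 1 - A + (1 - s) *\<^sub>R J"
  \<comment> \<open>The determinant of the second factor as a polynomial in \<open>s\<close>: its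
    entries are those of \<open>(J - A) + s *\<^sub>R (mat 1 - J)\<close>.\<close>
  define q where "q = det (\<chi> i j. [: J $ i $ j - A $ i $ j, mat 1 $ i $ j - J $ i $ j :])"
  have q: "poly q s = det (?N s)" for s
    unfolding q_def poly_det
    by (intro arg_cong [where f = det]) (simp add: vec_eq_iff algebra_simps)
  have "poly (char_polynomial A) s = poly (monom 1 (rank J) * q) s" for s
  proof -
    have "(mat 1 + (s - 1) *\<^sub>R J) ** ?N s = s *\<^sub>R mat 1 - A"
      by (simp add: matrix_mult_algebra JA JJ algebra_simps)
    then have "det (s *\<^sub>R mat 1 - A) = det (mat 1 + (s - 1) *\<^sub>R J) * det (?N s)"
      by (metis det_mul)
    then show ?thesis
      by (simp add: poly_char_polynomial q det_projection [OF JJ] poly_monom)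
  qed
  then have char: "char_polynomial A = monom 1 (rank J) * q"
    by (simp add: fun_eq_iff flip: poly_eq_poly_eq_iff)
  \<comment> \<open>Applying \<open>J\<close> to \<open>J *v x = A *v x\<close> annihilates the
    right side, so both sides vanish and \<open>ker\<close> gives
    \<open>x = J *v x = 0\<close>.\<close>
  have "x = 0" if "(J - A) *v x = 0" for x
  proof -
    have eq: "J *v x = A *v x"
      using that by (simp add: matrix_vector_mult_diff_rdistrib)
    have "J *v x = J *v (J *v x)"
      by (simp add: matrix_vector_mul_assoc JJ)
    also have "\<dots> = 0"
      by (simp add: eq matrix_vector_mul_assoc JA)
    finally show "x = 0"
      using eq ker [of x] by simp
  qed
  then have "det (J - A) \<noteq> 0"
    unfolding invertible_det_nz [symmetric] invertible_left_inverse matrix_left_invertible_ker by blast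
  then have "poly q 0 \<noteq> 0"
    by (simp add: q)
  then have "order 0 q = 0" "q \<noteq> 0"
    by (auto intro: order_0I)
  then show ?thesis
    by (simp add: algebraic_multiplicity_def char order_mult order_0_monom)
qed

section \<open>Semistable matrices and the pseudo Gramian\<close>

text \<open>The limit is a parameter, so that the transposed matrix with limit
  \<open>transpose J\<close> is a second instance.\<close>

locale semistable_matrix =
  fixes A J :: "real^'n^'n"
  assumes lim: "((\<lambda>t. matrix_exp (t *\<^sub>R A)) \<longlongrightarrow> J) at_top"
begin

section \<open>Algebra of the limit projection\<close>

abbreviation E :: "real \<Rightarrow> real^'n^'n" where
  "E t \<equiv> matrix_exp (t *\<^sub>R A)"

lemma limit_matrix_eq: "limit_matrix A = J"
  unfolding limit_matrix_def by (intro tendsto_Lim lim) simp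

lemma semistable_transpose: "semistable_matrix (transpose A) (transpose J)"
proof
  show "((\<lambda>t. matrix_exp (t *\<^sub>R transpose A)) \<longlongrightarrow> transpose J) at_top"
    unfolding transpose_scalar [symmetric] matrix_exp_transpose
    by (intro bounded_linear.tendsto [OF bounded_linear_transpose] lim)
qed

text \<open>The limit ignores time shifts; splitting off \<open>E s\<close> on either side then
  shows that \<open>J\<close> absorbs the exponential.\<close>

lemma exp_shift_tendsto: "((\<lambda>t. E (s + t)) \<longlongrightarrow> J) at_top"
  by (intro filterlim_compose [OF lim] filterlim_tendsto_add_at_top [OF tendsto_const]
      filterlim_ident)

lemma exp_J: "E s ** J = J"
proof (rule tendsto_unique [OF _ _ exp_shift_tendsto])
  show "((\<lambda>t. E (s + t)) \<longlongrightarrow> E s ** J) at_top"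
    unfolding matrix_exp_add by (intro tendsto_matrix_mult tendsto_const lim)
qed simp

lemma J_exp: "J ** E s = J"
proof (rule tendsto_unique [OF _ _ exp_shift_tendsto])
  show "((\<lambda>t. E (s + t)) \<longlongrightarrow> J ** E s) at_top"
    unfolding add.commute [of s] matrix_exp_add by (intro tendsto_matrix_mult tendsto_const lim)
qed simp

lemma J_J: "J ** J = J"
proof (rule tendsto_unique)
  show "((\<lambda>t. E t ** J) \<longlongrightarrow> J ** J) at_top"
    by (intro tendsto_matrix_mult tendsto_const lim)
qed (simp_all add: exp_J)

text \<open>Derivative at 0 of the constant function \<open>E t ** J\<close>.\<close>

lemma A_J: "A ** J = 0"
proof -
  have "((\<lambda>t. E t ** J) has_vector_derivative (A ** E 0) ** J) (at 0)"
    by (intro bounded_linear.has_vector_derivative [OF bounded_bilinear.bounded_linear_left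
          [OF bounded_bilinear_matrix_matrix_mult]] matrix_exp_has_vector_derivative)
  then have "((\<lambda>t. J) has_vector_derivative A ** J) (at 0)"
    by (simp add: exp_J)
  then show ?thesis
    using vector_derivative_unique_at [OF _ has_vector_derivative_const] by blast
qed

text \<open>\<open>E t ** A\<close> equals \<open>A ** E t\<close>, which tends to
  \<open>A ** J = 0\<close>.\<close>

lemma J_A: "J ** A = 0"
proof (rule tendsto_unique)
  show "((\<lambda>t. E t ** A) \<longlongrightarrow> J ** A) at_top"
    by (intro tendsto_matrix_mult tendsto_const lim)
  show "((\<lambda>t. E t ** A) \<longlongrightarrow> 0) at_top"
    unfolding matrix_exp_commute [symmetric] A_J [symmetric]
    by (intro tendsto_matrix_mult tendsto_const lim)
qed simp

lemma exp_kernel: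
  assumes "A *v x = 0"
  shows "E t *v x = x"
proof -
  have "((\<lambda>t. E t *v x) has_vector_derivative 0) (at t)" for t
    using matrix_exp_vector_has_vector_derivative [of A x t UNIV] assms
    by (simp add: matrix_vector_mul_assoc matrix_exp_commute)
       (simp flip: matrix_vector_mul_assoc)
  then obtain c where "\<And>t. E t *v x = c"
    using has_vector_derivative_zero_constant [of UNIV "\<lambda>t. E t *v x"] by auto
  then have "E t *v x = E 0 *v x"
    by metis
  then show ?thesis
    by simp
qed

text \<open>Kernel vectors are equilibria and hence their own limits; conversely
  \<open>A ** J = 0\<close>.\<close>

lemma kernel_iff: "A *v x = 0 \<longleftrightarrow> J *v x = x"
proof
  assume "A *v x = 0"
  then have "((\<lambda>t :: real. x) \<longlongrightarrow> J *v x) at_top"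
    using tendsto_matrix_vector_mult [OF lim tendsto_const [of x]] by (simp add: exp_kernel)
  then show "J *v x = x"
    by (simp add: tendsto_const_iff)
next
  assume "J *v x = x"
  then have "A *v x = (A ** J) *v x"
    by (metis matrix_vector_mul_assoc)
  then show "A *v x = 0"
    by (simp add: A_J)
qed

lemma algebraic_multiplicity_eq_rank: "algebraic_multiplicity A 0 = rank J"
  by (rule algebraic_multiplicity_0_eq_rank [OF A_J J_A J_J]) (simp add: kernel_iff)

text \<open>Semisimplicity of the eigenvalue zero: the kernel of \<open>A\<close> is the range of
  \<open>J\<close>, whose rank is the algebraic multiplicity.\<close>

lemma dim_kernel: "dim {x. A *v x = 0} = algebraic_multiplicity A 0"
proof -
  have "J *v (J *v x) = J *v x" for x
    by (simp add: matrix_vector_mul_assoc J_J)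
  then have "{x. A *v x = 0} = range ((*v) J)"
    unfolding kernel_iff by (auto intro: range_eqI [OF sym])
  then show ?thesis
    by (simp add: algebraic_multiplicity_eq_rank rank_dim_range)
qed

section \<open>Decay of the transient part\<close>

abbreviation F :: "real \<Rightarrow> real^'n^'n" where
  "F t \<equiv> E t - J"

text \<open>Both cross terms and \<open>J ** J\<close> equal \<open>J\<close>, so expanding the
  product leaves a single \<open>- J\<close>.\<close>

lemma F_add: "F (s + t) = F s ** F t"
  by (simp add: matrix_exp_add matrix_mult_algebra exp_J J_exp J_J)

lemma continuous_on_F: "continuous_on S F"
  by (intro continuous_on_diff continuous_on_matrix_exp continuous_on_const)

lemma F_vector: "F t *v x = E t *v (x - J *v x)"
  by (simp add: matrix_vector_mult_diff_distrib matrix_vector_mult_diff_rdistrib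
      matrix_vector_mul_assoc exp_J)

text \<open>Once \<open>F \<tau>\<close> is a contraction by the factor \<open>1 / 2\<close>, the semigroup law \<open>F_add\<close> forces
  decay at the rate \<open>ln 2 / \<tau>\<close>.\<close>

lemma exponential_decay:
  obtains D c where "c > 0" "\<And>t. t \<ge> 0 \<Longrightarrow> norm (F t) \<le> D * exp (- c * t)"
proof -
  obtain K where K: "K > 0" "\<And>(X :: real^'n^'n) (Y :: real^'n^'n). norm (X ** Y) \<le> norm X * norm Y * K"
    using bounded_bilinear.pos_bounded [OF bounded_bilinear_matrix_matrix_mult] by blast
  have "(F \<longlongrightarrow> 0) at_top"
    using tendsto_diff [OF lim tendsto_const [of J]] by simp
  then have "\<forall>\<^sub>F t in at_top. norm (F t) < 1 / (2 * K)"
    using K(1) tendstoD [of F 0 at_top "1 / (2 * K)"] by (simp add: dist_norm)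
  \<comment> \<open>The \<open>K\<close> in the threshold absorbs the constant of the product
    inequality, leaving the factor 1/2 in \<open>half\<close>.\<close>
  then obtain \<tau> where \<tau>: "\<tau> > 0" "norm (F \<tau>) < 1 / (2 * K)"
    using eventually_happens' [OF _ eventually_conj [OF eventually_gt_at_top [of 0]]]
      trivial_limit_at_top_linorder by blast
  have "bounded (F ` {0..\<tau>})"
    by (intro compact_imp_bounded compact_continuous_image continuous_on_F compact_Icc)
  then obtain M where M: "M > 0" "\<And>t. t \<in> {0..\<tau>} \<Longrightarrow> norm (F t) \<le> M"
    by (auto simp: bounded_pos)
  define c where "c = ln 2 / \<tau>"
  have c: "c > 0" "exp (- c * \<tau>) = 1 / 2"
    using \<tau> by (simp_all add: c_def exp_minus)
  have half: "norm (F (\<tau> + t)) \<le> norm (F t) / 2" for t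
  proof -
    have "norm (F (\<tau> + t)) \<le> norm (F \<tau>) * norm (F t) * K"
      unfolding F_add by (rule K)
    also have "\<dots> \<le> 1 / (2 * K) * norm (F t) * K"
      using \<tau> K(1) by (intro mult_right_mono) auto
    finally show ?thesis
      using K(1) by simp
  qed
  \<comment> \<open>Induction on the number of periods of length \<open>\<tau>\<close>. The factor 2
    in \<open>2 * M\<close> covers the first period, where the exponential is at least 1/2.\<close>
  have decay: "norm (F t) \<le> 2 * M * exp (- c * t)" if "0 \<le> t" "t \<le> real n * \<tau>" for n t
    using that
  proof (induction n arbitrary: t)
    case 0
    then show ?case
      using M(1) M(2) [of 0] \<tau> by simp
  next
    case (Suc n)
    show ?case
    proof (cases "t \<le> \<tau>")
      case True
      have "c * t \<le> c * \<tau>"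
        using True c(1) by simp
      then have "1 / 2 \<le> exp (- c * t)"
        unfolding c(2) [symmetric] by simp
      then have "M \<le> 2 * M * exp (- c * t)"
        using M(1) by (simp add: field_simps)
      then show ?thesis
        using M(2) [of t] True Suc.prems by simp
    next
      case False
      have "norm (F t) \<le> norm (F (t - \<tau>)) / 2"
        using half [of "t - \<tau>"] by simp
      also have "norm (F (t - \<tau>)) \<le> 2 * M * exp (- c * (t - \<tau>))"
        using False Suc.prems by (intro Suc.IH) (auto simp: algebra_simps)
      also have "exp (- c * (t - \<tau>)) = 2 * exp (- c * t)"
        using c(2) by (simp add: algebra_simps exp_add exp_diff exp_minus divide_simps)
      finally show ?thesis
        by simp
    qed
  qed
  have "norm (F t) \<le> 2 * M * exp (- c * t)" if "t \<ge> 0" for t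
  proof -
    obtain n where "t / \<tau> \<le> real n"
      using real_arch_simple by blast
    then show ?thesis
      using decay [of t n] that \<tau>(1) by (simp add: field_simps)
  qed
  with c(1) that show thesis
    by blast
qed

section \<open>The Gramian integral and its kernel\<close>

definition integrand :: "real^'n^'q \<Rightarrow> real \<Rightarrow> real^'n^'n" where
  "integrand C t = transpose (F t) ** transpose C ** C ** F t"

lemma pseudo_obsv_gramian_eq: "pseudo_obsv_gramian A C = integral {0..} (integrand C)"
proof -
  have "matrix_exp (t *\<^sub>R transpose A) - transpose J = transpose (F t)" for t
    unfolding transpose_scalar [symmetric] matrix_exp_transpose
    by (simp add: transpose_def vec_eq_iff)
  then show ?thesis
    by (simp add: pseudo_obsv_gramian_def integrand_def [abs_def] limit_matrix_eq)
qed

text \<open>Exponential decay dominates the integrand. Without convergence, \<open>integral\<close>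
  would return its default value 0.\<close>

lemma integrand_integrable: "integrand C integrable_on {0..}"
proof -
  obtain D c where Dc: "c > 0" "\<And>t. t \<ge> 0 \<Longrightarrow> norm (F t) \<le> D * exp (- c * t)"
    using exponential_decay by blast
  have "bounded_bilinear (\<lambda>(X :: real^'n^'n) (Y :: real^'n^'n). (transpose X ** (transpose C ** C)) ** Y)"
    by (rule bounded_bilinear.comp1 [OF bounded_bilinear_matrix_matrix_mult])
       (intro bounded_linear_compose [OF bounded_bilinear.bounded_linear_left
          [OF bounded_bilinear_matrix_matrix_mult] bounded_linear_transpose])
  then obtain K where K: "K > 0"
      "\<And>(X :: real^'n^'n) (Y :: real^'n^'n). norm ((transpose X ** (transpose C ** C)) ** Y) \<le> norm X * norm Y * K"
    using bounded_bilinear.pos_bounded by blast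
  show ?thesis
  proof (rule measurable_bounded_by_integrable_imp_integrable)
    have "continuous_on {0..} (integrand C)"
      unfolding integrand_def
      by (intro continuous_on_matrix_mult continuous_on_const continuous_on_F
          bounded_linear.continuous_on [OF bounded_linear_transpose])
    then show "integrand C \<in> borel_measurable (lebesgue_on {0..})"
      by (intro continuous_imp_measurable_on_sets_lebesgue) auto
    show "(\<lambda>t. K * D\<^sup>2 * exp (- (2 * c) * t)) integrable_on {0..}"
      using Dc(1) integrable_on_exp_minus_to_infinity [of "2 * c" 0]
      by (intro integrable_on_mult_right) simp
    show "norm (integrand C t) \<le> K * D\<^sup>2 * exp (- (2 * c) * t)" if "t \<in> {0..}" for t
    proof -
      have "norm (integrand C t) \<le> norm (F t) * norm (F t) * K"
        using K(2) [of "F t" "F t"] by (simp add: integrand_def matrix_mul_assoc)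
      also have "\<dots> \<le> (D * exp (- c * t)) * (D * exp (- c * t)) * K"
        using that K(1) Dc(2) [of t] order_trans [OF norm_ge_zero Dc(2) [of t]]
        by (intro mult_right_mono mult_mono) auto
      also have "\<dots> = K * D\<^sup>2 * (exp (- c * t) * exp (- c * t))"
        by (simp add: power2_eq_square)
      also have "\<dots> = K * D\<^sup>2 * exp (- (2 * c) * t)"
        by (simp flip: exp_add)
      finally show ?thesis .
    qed
  qed simp
qed

lemma gramian_vector_has_integral:
  "((\<lambda>t. integrand C t *v x) has_integral pseudo_obsv_gramian A C *v x) {0..}"
  using has_integral_linear [OF integrable_integral [OF integrand_integrable]
      bounded_bilinear.bounded_linear_left [OF bounded_bilinear_matrix_vector_mult]]
  by (simp add: o_def pseudo_obsv_gramian_eq)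

lemma inner_integrand: "x \<bullet> (integrand C t *v x) = (C *v (F t *v x)) \<bullet> (C *v (F t *v x))"
proof -
  have "integrand C t *v x = transpose (F t) *v (transpose C *v (C *v (F t *v x)))"
    unfolding integrand_def by (simp only: matrix_vector_mul_assoc matrix_mul_assoc)
  then show ?thesis
    by (metis dot_lmul_matrix inner_commute transpose_matrix_vector)
qed

text \<open>The quadratic form at \<open>x\<close> integrates a continuous nonnegative function, so
  a zero integral forces it to vanish pointwise. Conversely the integrand applied to
  \<open>x\<close> is zero.\<close>

lemma gramian_kernel_iff:
  "pseudo_obsv_gramian A C *v x = 0 \<longleftrightarrow> (\<forall>t\<ge>0. C *v (F t *v x) = 0)"
proof
  assume Q: "pseudo_obsv_gramian A C *v x = 0"
  let ?h = "\<lambda>t. (C *v (F t *v x)) \<bullet> (C *v (F t *v x))"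
  have hi: "(?h has_integral 0) {0..}"
    using has_integral_linear [OF gramian_vector_has_integral [of C x] bounded_linear_inner_right [of x]]
    by (simp add: o_def inner_integrand Q)
  show "\<forall>t\<ge>0. C *v (F t *v x) = 0"
  proof (intro allI impI)
    fix t :: real assume t: "t \<ge> 0"
    \<comment> \<open>Restriction to a compact interval; the end point \<open>t + 1\<close> keeps it
      nondegenerate when \<open>t = 0\<close>.\<close>
    have cont: "continuous_on {0..t + 1} ?h"
      by (intro continuous_on_inner continuous_on_matrix_vector_mult continuous_on_const continuous_on_F)
    then have int: "(?h has_integral integral {0..t + 1} ?h) {0..t + 1}"
      by (intro integrable_integral integrable_continuous_interval)
    have "integral {0..t + 1} ?h \<le> 0"
      by (rule has_integral_subset_le [OF _ int hi]) auto
    moreover have "integral {0..t + 1} ?h \<ge> 0"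
      by (rule has_integral_nonneg [OF int]) simp
    ultimately have "(?h has_integral 0) (cbox 0 (t + 1))"
      using int by simp
    then have "?h t = 0"
      using has_integral_0_cbox_imp_0 [of 0 "t + 1" ?h t] cont t by simp
    then show "C *v (F t *v x) = 0"
      by simp
  qed
next
  assume *: "\<forall>t\<ge>0. C *v (F t *v x) = 0"
  have "integrand C t *v x = (transpose (F t) ** transpose C) *v (C *v (F t *v x))" for t
    unfolding integrand_def by (simp only: matrix_vector_mul_assoc matrix_mul_assoc)
  with * have "integrand C t *v x = 0" if "t \<in> {0..}" for t
    using that by (metis atLeast_iff matrix_vector_mult_0_right)
  then show "pseudo_obsv_gramian A C *v x = 0"
    using has_integral_unique [OF gramian_vector_has_integral has_integral_is_0] by blast
qed

lemma kernel_subset_gramian_kernel: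
  "{x. A *v x = 0} \<subseteq> {x. pseudo_obsv_gramian A C *v x = 0}"
  by (auto simp: gramian_kernel_iff F_vector kernel_iff)

text \<open>By rank-nullity the rank condition equates the dimensions of the two kernels, and one
  already contains the other.\<close>

lemma rank_gramian_iff:
  "rank (pseudo_obsv_gramian A C) = CARD('n) - algebraic_multiplicity A 0 \<longleftrightarrow>
    (\<forall>x. pseudo_obsv_gramian A C *v x = 0 \<longrightarrow> A *v x = 0)" (is "?rank \<longleftrightarrow> ?ker")
proof -
  let ?K = "{x. A *v x = 0}" and ?G = "{x. pseudo_obsv_gramian A C *v x = 0}"
  have "?rank \<longleftrightarrow> dim ?G = dim ?K"
    \<comment> \<open>The instance for \<open>A\<close> bounds the multiplicity by
      \<open>CARD('n)\<close>, so the subtraction of naturals is exact.\<close>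
    using rank_plus_dim_kernel [of "pseudo_obsv_gramian A C"] rank_plus_dim_kernel [of A]
    by (auto simp: dim_kernel)
  also have "\<dots> \<longleftrightarrow> ?K = ?G"
    using subspace_dim_equal [OF subspace_matrix_kernel subspace_matrix_kernel
        kernel_subset_gramian_kernel [of C]] by (metis order_refl)
  also have "\<dots> \<longleftrightarrow> ?ker"
    using kernel_subset_gramian_kernel [of C] by blast
  finally show ?thesis .
qed

lemma unobservable_space_iff_gramian:
  "unobservable_space A C = {0} \<longleftrightarrow>
    rank (pseudo_obsv_gramian A C) = CARD('n) - algebraic_multiplicity A 0 \<and>
    (\<forall>x. x \<noteq> 0 \<and> A *v x = 0 \<longrightarrow> C *v x \<noteq> 0)"
proof
  assume U: "unobservable_space A C = {0}"
  have "A *v x = 0" if "pseudo_obsv_gramian A C *v x = 0" for x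
  proof -
    have "C *v (E t *v (x - J *v x)) = 0" if "t \<in> {0..1}" for t
      using that \<open>pseudo_obsv_gramian A C *v x = 0\<close> by (simp add: gramian_kernel_iff F_vector)
    then have "x - J *v x \<in> unobservable_space A C"
      by (rule output_zero_unobservable_space [OF zero_less_one])
    then show ?thesis
      using U by (simp add: kernel_iff)
  qed
  \<comment> \<open>An equilibrium has constant output \<open>C *v x\<close>.\<close>
  moreover have "x = 0" if "A *v x = 0" "C *v x = 0" for x
  proof -
    have "x \<in> unobservable_space A C"
      by (rule output_zero_unobservable_space [OF zero_less_one]) (simp add: exp_kernel that)
    then show ?thesis
      using U by simp
  qed
  ultimately show "rank (pseudo_obsv_gramian A C) = CARD('n) - algebraic_multiplicity A 0 \<and>
      (\<forall>x. x \<noteq> 0 \<and> A *v x = 0 \<longrightarrow> C *v x \<noteq> 0)"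
    unfolding rank_gramian_iff by blast
next
  assume "rank (pseudo_obsv_gramian A C) = CARD('n) - algebraic_multiplicity A 0 \<and>
      (\<forall>x. x \<noteq> 0 \<and> A *v x = 0 \<longrightarrow> C *v x \<noteq> 0)"
  then have Q: "\<And>x. pseudo_obsv_gramian A C *v x = 0 \<Longrightarrow> A *v x = 0"
    and C: "\<And>x. A *v x = 0 \<Longrightarrow> C *v x = 0 \<Longrightarrow> x = 0"
    unfolding rank_gramian_iff by blast+
  have "x = 0" if x: "x \<in> unobservable_space A C" for x
  proof -
    note out = unobservable_space_output_zero [OF x]
    \<comment> \<open>Letting \<open>t\<close> grow in the zero output gives
      \<open>C *v (J *v x) = 0\<close>. As \<open>J *v x\<close> is in the kernel of
      \<open>A\<close>, it vanishes, so \<open>F t *v x\<close> is the free motion from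
      \<open>x\<close> itself.\<close>
    have "((\<lambda>t. C *v (E t *v x)) \<longlongrightarrow> C *v (J *v x)) at_top"
      by (intro tendsto_matrix_vector_mult tendsto_const lim)
    then have "C *v (J *v x) = 0"
      by (simp add: out tendsto_const_iff)
    moreover have "A *v (J *v x) = 0"
      by (simp add: matrix_vector_mul_assoc A_J)
    ultimately have J: "J *v x = 0"
      by (rule C [rotated])
    then have "A *v x = 0"
      using Q by (simp add: gramian_kernel_iff F_vector out)
    with J show "x = 0"
      by (simp add: kernel_iff)
  qed
  then show "unobservable_space A C = {0}"
    using zero_in_unobservable_space by blast
qed

end

text \<open>The columns of the exponential are free trajectories from the basis vectors; their
  limits are the columns of \<open>J\<close>.\<close>

lemma semistable_limit:
  fixes A :: "real^'n^'n" and B :: "real^'p^'n"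
  assumes "semistable A B"
  obtains J where "semistable_matrix A J"
proof -
  have "\<exists>l. ((\<lambda>t. matrix_exp (t *\<^sub>R A) *v axis j 1) \<longlongrightarrow> l) at_top" for j
    using assms trajectory_matrix_exp unfolding semistable_def by blast
  then obtain l where l: "\<And>j. ((\<lambda>t. matrix_exp (t *\<^sub>R A) *v axis j 1) \<longlongrightarrow> l j) at_top"
    by metis
  have "((\<lambda>t. matrix_exp (t *\<^sub>R A)) \<longlongrightarrow> (\<chi> i j. l j $ i)) at_top"
  proof (intro vec_tendstoI)
    fix i j
    show "((\<lambda>t. matrix_exp (t *\<^sub>R A) $ i $ j) \<longlongrightarrow> (\<chi> i j. l j $ i) $ i $ j) at_top"
      using tendsto_vec_nth [OF l [of j], of i] by (simp add: matrix_vector_mult_basis column_def)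
  qed
  then show thesis
    using that by (simp add: semistable_matrix_def)
qed

theorem theorem2:
  fixes A :: "real^'n^'n" and B :: "real^'p^'n" and C :: "real^'n^'q" and m :: nat
  assumes "semistable A B"
    and "m = algebraic_multiplicity A 0"
  shows "(controllable A B \<longleftrightarrow>
            rank (pseudo_ctrb_gramian A B) = CARD('n) - m \<and>
            (\<forall>\<xi>. \<xi> \<noteq> 0 \<and> transpose A *v \<xi> = 0 \<longrightarrow> \<xi> v* B \<noteq> 0)) \<and>
         (observable A B C \<longleftrightarrow>
            rank (pseudo_obsv_gramian A C) = CARD('n) - m \<and>
            (\<forall>\<xi>. \<xi> \<noteq> 0 \<and> A *v \<xi> = 0 \<longrightarrow> C *v \<xi> \<noteq> 0))"
proof -
  obtain J where J: "semistable_matrix A J"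
    using semistable_limit [OF assms(1)] .
  interpret semistable_matrix A J
    by (fact J)
  interpret dual: semistable_matrix "transpose A" "transpose J"
    by (rule semistable_transpose)
  \<comment> \<open>Duality: the observability criterion for the transposed pair gives the
    controllability part.\<close>
  have "pseudo_ctrb_gramian A B = pseudo_obsv_gramian (transpose A) (transpose B)"
    by (simp add: pseudo_ctrb_gramian_def pseudo_obsv_gramian_def limit_matrix_eq
        dual.limit_matrix_eq)
  \<comment> \<open>Both multiplicities are ranks of limits, and \<open>J\<close> and
    \<open>transpose J\<close> have equal rank.\<close>
  moreover have "algebraic_multiplicity (transpose A) 0 = m"
    using assms(2) by (simp add: algebraic_multiplicity_eq_rank dual.algebraic_multiplicity_eq_rank
        rank_transpose)
  moreover have "transpose B *v \<xi> = \<xi> v* B" for \<xi>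
    by simp
  ultimately show ?thesis
    unfolding controllable_iff_unobservable_space observable_iff_unobservable_space
      unobservable_space_iff_gramian dual.unobservable_space_iff_gramian assms(2)
    by simp
qed

end
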